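(* Let $\sqsubset$ be an admissible monomial ordering on $\mathbb{M}$. The division $D_\sqsubset$ induced by $\sqsubset$ is monotone for the ordering $\sqsubset$.
   Context: $\mathbb{M}=\{x_1^{d_1}\cdots x_n^{d_n}\mid d_i\in\mathbb{Z}_{\ge 0}\}$, and $\deg_i(u)$ is the degree of $x_i$ in $u$. An admissible monomial ordering is a total ordering on $\mathbb{M}$, compatible with multiplication, in which $1$ is the smallest element. All monomial sets are finite. Induced division $D_\sqsubset$: for a finite set $U\subset\mathbb{M}$ and $u\in U$, the variable $x_i$ is nonmultiplicative for $u$ if there is $v\in U$ such that $v\sqsubset u$ and $\deg_i(u)<\deg_i(v)$, and multiplicative otherwise. For a division $L$, $NM_L(u,U)$ is the set of nonmultiplicative variables of $u\in U$, $L(u,U)$ is the submonoid of $\mathbb{M}$ generated by the multiplicative variables, and the involutive cone is $C_L(U)=\bigcup_{u\in U}uL(u,U)$. A set $U$ is complete up to a monomial $w$ with respect to $\sqsubset$ if for all $u\in U$ and $x\in NM_L(u,U)$ with $u\cdot x\sqsubseteq w$ one has $u\cdot x\in C_L(U)$ (in particular, $U$ is complete up to $w$ if $u\cdot x\sqsupset w$ for all $u\in U$, $x\in NM_L(u,U)$). $L$ is monotone for $\sqsubset$ if for any finite set $U$ and any $w\in\mathbb{M}$ such that $U$ is complete up to $w$ with respect to $\sqsubset$, the following holds: for all $v\in U$ and $x\in NM_L(v,U)$ with $v\cdot x\notin C_L(U)$, the set $U\cup\{v\cdot x\}$ is complete up to $w$ with respect to $\sqsubset$. *)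

theory Defs
  imports "HOL-Library.Poly_Mapping"
begin

text \<open>
  The monomials in the variables indexed by the finite type \<open>'n\<close> are represented by their
  exponent vectors. Hence multiplication of monomials is written additively, the monomial
  \<open>1\<close> is \<open>0\<close>, and the degree of the variable \<open>i\<close> in \<open>u\<close> is \<open>Poly_Mapping.lookup u i\<close>.
\<close>

type_synonym 'n monomial = "'n \<Rightarrow>\<^sub>0 nat"

definition var :: "'n \<Rightarrow> 'n monomial" where
  "var i = Poly_Mapping.single i 1"

text \<open>Orderings are given by their strict part \<open>lt\<close>; the weak part is \<open>lt\<^sup>=\<^sup>=\<close>.\<close>

definition admissible_ordering :: "('n::finite monomial \<Rightarrow> 'n monomial \<Rightarrow> bool) \<Rightarrow> bool" where
  "admissible_ordering lt \<longleftrightarrow>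
     irreflp lt \<and> transp lt \<and> totalp lt \<and>
     (\<forall>u v w. lt u v \<longrightarrow> lt (u + w) (v + w)) \<and>
     (\<forall>u. lt\<^sup>=\<^sup>= 0 u)"

text \<open>
  A division is represented by the function assigning to \<open>u\<close> and \<open>U\<close> the set of (indices of)
  nonmultiplicative variables of \<open>u\<close> in \<open>U\<close>. Only its values for finite \<open>U\<close> and
  \<open>u \<in> U\<close> are meaningful.
\<close>

type_synonym 'n division = "'n monomial \<Rightarrow> 'n monomial set \<Rightarrow> 'n set"

inductive_set submonoid_generated :: "'a::monoid_add set \<Rightarrow> 'a set" for S where
  zero: "0 \<in> submonoid_generated S"
| generator: "s \<in> S \<Longrightarrow> s \<in> submonoid_generated S"
| add: "\<lbrakk>a \<in> submonoid_generated S; b \<in> submonoid_generated S\<rbrakk>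
    \<Longrightarrow> a + b \<in> submonoid_generated S"

definition mult_monoid ::
  "'n::finite division \<Rightarrow> 'n monomial \<Rightarrow> 'n monomial set \<Rightarrow> 'n monomial set" where
  "mult_monoid NM u U = submonoid_generated {var i | i. i \<notin> NM u U}"

definition involutive_cone :: "'n::finite division \<Rightarrow> 'n monomial set \<Rightarrow> 'n monomial set" where
  "involutive_cone NM U = (\<Union>u\<in>U. {u + m | m. m \<in> mult_monoid NM u U})"

definition induced_division ::
  "('n::finite monomial \<Rightarrow> 'n monomial \<Rightarrow> bool) \<Rightarrow> 'n division" where
  "induced_division lt u U = {i. \<exists>v\<in>U. lt v u \<and> Poly_Mapping.lookup u i < Poly_Mapping.lookup v i}"

definition complete_up_to ::
  "'n::finite division \<Rightarrow> ('n monomial \<Rightarrow> 'n monomial \<Rightarrow> bool) \<Rightarrow>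
   'n monomial \<Rightarrow> 'n monomial set \<Rightarrow> bool" where
  "complete_up_to NM lt w U \<longleftrightarrow>
     (\<forall>u\<in>U. \<forall>i\<in>NM u U. lt\<^sup>=\<^sup>= (u + var i) w \<longrightarrow> u + var i \<in> involutive_cone NM U)"

definition monotone_division ::
  "'n::finite division \<Rightarrow> ('n monomial \<Rightarrow> 'n monomial \<Rightarrow> bool) \<Rightarrow> bool" where
  "monotone_division NM lt \<longleftrightarrow>
     (\<forall>U w. finite U \<longrightarrow> complete_up_to NM lt w U \<longrightarrow>
       (\<forall>v\<in>U. \<forall>i\<in>NM v U. v + var i \<notin> involutive_cone NM U \<longrightarrow>
          complete_up_to NM lt w (U \<union> {v + var i})))"

end

theory Submission
  imports Defs
begin

text \<open>
  Whether a variable is nonmultiplicative for \<open>u\<close> under the division induced by \<open>lt\<close> depends only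
  on the elements of \<open>U\<close> strictly below \<open>u\<close>. Enlarging \<open>U\<close> by a monomial \<open>p\<close> that is not below
  \<open>u\<close> therefore leaves the cone of \<open>u\<close> unchanged.

  Let \<open>U\<close> be complete up to \<open>w\<close>. A prolongation \<open>p = v + var i\<close> missing from the involutive cone
  must lie strictly above \<open>w\<close>. Completeness up to \<open>w\<close> concerns only monomials \<open>u + var j\<close> that are
  at most \<open>w\<close>, and both \<open>u\<close> and any involutive divisor of \<open>u + var j\<close> are at most \<open>u + var j\<close>. So
  \<open>p\<close> is not below them, their nonmultiplicative variables survive the enlargement, and the old
  involutive divisor of \<open>u + var j\<close> is still one in \<open>insert p U\<close>
  (lemma \<open>complete_up_to_insert_above\<close>).
\<close>

lemma admissible_less_eq_add:
  assumes "admissible_ordering lt"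
  shows "lt\<^sup>=\<^sup>= u (u + m)"
proof -
  have "m = 0 \<or> lt 0 m"
    using assms by (auto simp: admissible_ordering_def)
  moreover have "lt (0 + u) (m + u)" if "lt 0 m"
    using assms that unfolding admissible_ordering_def by blast
  ultimately show ?thesis
    by (auto simp: add.commute)
qed

lemma induced_division_insert_not_below:
  assumes "\<not> lt p u"
  shows "induced_division lt u (insert p U) = induced_division lt u U"
  using assms by (auto simp: induced_division_def)

lemma complete_up_to_insert_above:
  assumes adm: "admissible_ordering lt"
    and complete: "complete_up_to (induced_division lt) lt w U"
    and above: "lt w p"
  shows "complete_up_to (induced_division lt) lt w (insert p U)"
  unfolding complete_up_to_def
proof (intro ballI impI)
  fix u j
  assume u: "u \<in> insert p U" and j: "j \<in> induced_division lt u (insert p U)"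
    and below: "lt\<^sup>=\<^sup>= (u + var j) w"
  have trans: "lt a c" if "lt a b" "lt b c" for a b c
    using adm that by (auto simp: admissible_ordering_def dest: transpD)
  have irrefl: "\<not> lt a a" for a
    using adm by (auto simp: admissible_ordering_def dest: irreflpD)
  \<comment> \<open>Every divisor of \<open>u + var j\<close> is at most \<open>w\<close>, hence strictly below \<open>p\<close>.\<close>
  have divisor: "\<not> lt p d" "d \<noteq> p" if "u + var j = d + m" for d m
  proof -
    have "lt d p"
      using admissible_less_eq_add[OF adm, of d m] below above that by (auto intro: trans)
    then show "\<not> lt p d" "d \<noteq> p"
      using trans irrefl by blast+
  qed
  have "u \<in> U"
    using u divisor(2)[of u "var j", OF refl] by simp
  moreover have "j \<in> induced_division lt u U"
    using j induced_division_insert_not_below[of lt, OF divisor(1)[of u "var j", OF refl], of U] by simp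
  ultimately have "u + var j \<in> involutive_cone (induced_division lt) U"
    using complete below unfolding complete_up_to_def by blast
  then obtain d m where d: "d \<in> U" and eq: "u + var j = d + m"
    and m: "m \<in> mult_monoid (induced_division lt) d U"
    unfolding involutive_cone_def by blast
  have "m \<in> mult_monoid (induced_division lt) d (insert p U)"
    using m induced_division_insert_not_below[of lt, OF divisor(1)[OF eq], of U]
    by (simp add: mult_monoid_def)
  then show "u + var j \<in> involutive_cone (induced_division lt) (insert p U)"
    using d eq unfolding involutive_cone_def by blast
qed

theorem proposition4p15:
  fixes lt :: "'n::finite monomial \<Rightarrow> 'n monomial \<Rightarrow> bool"
  assumes "admissible_ordering lt"
  shows "monotone_division (induced_division lt) lt"
  unfolding monotone_division_def
proof (intro allI impI ballI)
  fix U :: "'n monomial set" and w v i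
  assume complete: "complete_up_to (induced_division lt) lt w U"
    and "v \<in> U" "i \<in> induced_division lt v U"
    and "v + var i \<notin> involutive_cone (induced_division lt) U"
  then have "\<not> lt\<^sup>=\<^sup>= (v + var i) w"
    unfolding complete_up_to_def by blast
  then have "lt w (v + var i)"
    using assms by (auto simp: admissible_ordering_def dest: totalpD)
  from complete_up_to_insert_above[OF assms complete this]
  show "complete_up_to (induced_division lt) lt w (U \<union> {v + var i})"
    by simp
qed

end
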